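(* Let $\mathbb K=(G,M,I)$ be a context. Let $\mathfrak D\subseteq \mathrm{Fm}_1\times\mathrm{Fm}_2$ be a set of formula pairs together with maps $r:\mathfrak D\to \mathtt{SC}^{left}/\!\equiv^{left}$, $e:\mathtt{SC}^{left}/\!\equiv^{left}\to\mathfrak D$, $r':\mathfrak D\to\mathtt{SC}^{right}/\!\equiv^{right}$, $e':\mathtt{SC}^{right}/\!\equiv^{right}\to\mathfrak D$ such that $r\circ e=\mathrm{id}$ and $r'\circ e'=\mathrm{id}$ on $\mathtt{SC}^{left}/\!\equiv^{left}$ and $\mathtt{SC}^{right}/\!\equiv^{right}$ respectively. For $x,y\in\mathfrak D$ define $x\sqcap y:=e(r(x)\wedge r(y))$, $x\sqcup y:=e'(r'(x)\vee r'(y))$, $\bar\neg x:=e(\neg r(x))$, $\lrcorner x:=e'(\neg r'(x))$, $\bot_{\mathfrak D}:=e([(\bot_{s_1},\boxminus_{\mathfrak o}\bot_{s_1})])$ and $\top_{\mathfrak D}:=e'([(\boxminus_{\mathfrak p}\bot_{s_2},\bot_{s_2})])$. Then $(\mathfrak D,\sqcap,\sqcup,\bar\neg,\lrcorner,\top_{\mathfrak D},\bot_{\mathfrak D})$ is a pure double Boolean algebra if and only if the following conditions hold: (a) $e\circ r\circ e'\circ r'=e'\circ r'\circ e\circ r$; (b) $e(r(x)\wedge r(e'(r'(x)\vee r'(y))))=e(r(x))$ and $e'(r'(x)\vee r'(e(r(x)\wedge r(y))))=e'(r'(x))$ for all $x,y\in\mathfrak D$; (c) $r(e'([(\boxminus_{\mathfrak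 p}\bot_{s_2},\bot_{s_2})]))=\neg[(\bot_{s_1},\boxminus_{\mathfrak o}\bot_{s_1})]$ and $r'(e([(\bot_{s_1},\boxminus_{\mathfrak o}\bot_{s_1})]))=\neg[(\boxminus_{\mathfrak p}\bot_{s_2},\bot_{s_2})]$; (d) for each $x\in\mathfrak D$, either $e(r(x))=x$ or $e'(r'(x))=x$.
   Context: Language. There are two sorts $s_1,s_2$, with disjoint nonempty sets of propositional variables $P_{s_1},P_{s_2}$. $\mathrm{Fm}_1$ (sort $s_1$) and $\mathrm{Fm}_2$ (sort $s_2$) are defined by simultaneous induction: $\varphi ::= p\mid \neg\varphi\mid\varphi\wedge\varphi\mid \Box_{\mathfrak p}\psi\mid \boxminus_{\mathfrak p}\psi$ ($p\in P_{s_1}$, $\psi\in\mathrm{Fm}_2$) and $\psi::= q\mid\neg\psi\mid\psi\wedge\psi\mid\Box_{\mathfrak o}\varphi\mid\boxminus_{\mathfrak o}\varphi$ ($q\in P_{s_2}$, $\varphi\in\mathrm{Fm}_1$). Other Boolean connectives are the usual abbreviations; $\bot_{s_i}$ is falsum of sort $s_i$. Semantics. A context is $\mathbb K=(G,M,I)$ with $G,M$ sets and $I\subseteq G\times M$. A $\mathbb K$-based model is $\mathfrak M=(G,M,I,v)$, where $v$ assigns to each $p\in P_{s_1}$ a subset of $G$ and to each $q\in P_{s_2}$ a subset of $M$. Sort-$s_1$ formulas are evaluated at $g\in G$, sort-$s_2$ formulas at $m\in M$: variables by $v$, Boolean connectives classically, and: $g\models\Box_{\mathfrak p}\psi$ iff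 for all $m$, $Igm$ implies $m\models\psi$; $m\models\Box_{\mathfrak o}\varphi$ iff for all $g$, $Igm$ implies $g\models\varphi$; $g\models\boxminus_{\mathfrak p}\psi$ iff for all $m$, $m\models\psi$ implies $Igm$; $m\models\boxminus_{\mathfrak o}\varphi$ iff for all $g$, $g\models\varphi$ implies $Igm$. Write $\models^{\mathfrak C_{\mathbb K}}_{s_i}\chi$ if the sort-$s_i$ formula $\chi$ holds at all points of sort $s_i$ in all $\mathbb K$-based models. Semiconcepts. A pair $(\varphi,\psi)\in\mathrm{Fm}_1\times\mathrm{Fm}_2$ is a left semiconcept if $\models^{\mathfrak C_{\mathbb K}}_{s_2}\boxminus_{\mathfrak o}\varphi\leftrightarrow\psi$, and a right semiconcept if $\models^{\mathfrak C_{\mathbb K}}_{s_1}\varphi\leftrightarrow\boxminus_{\mathfrak p}\psi$; the sets of these are $\mathtt{SC}^{left}$ and $\mathtt{SC}^{right}$. On $\mathtt{SC}^{left}$, $(\varphi_1,\psi_1)\equiv^{left}(\varphi_2,\psi_2)$ iff $\models^{\mathfrak C_{\mathbb K}}_{s_1}\varphi_1\leftrightarrow\varphi_2$; on $\mathtt{SC}^{right}$, $(\varphi_1,\psi_1)\equiv^{right}(\varphi_2,\psi_2)$ iff $\models^{\mathfrak C_{\mathbb K}}_{s_2}\psi_1\leftrightarrow\psi_2$. $[\cdot]$ denotes equivalence classes. On $\mathtt{SC}^{left}/\!\equiv^{left}$: $[(\varphi,\psi)]\wedge[(\varphi',\psi')]:=[(\varphi\wedge\varphi',\boxminus_{\mathfrak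 o}(\varphi\wedge\varphi'))]$, $\neg[(\varphi,\psi)]:=[(\neg\varphi,\boxminus_{\mathfrak o}\neg\varphi)]$. On $\mathtt{SC}^{right}/\!\equiv^{right}$: $[(\varphi,\psi)]\vee[(\varphi',\psi')]:=[(\boxminus_{\mathfrak p}(\psi\wedge\psi'),\psi\wedge\psi')]$, $\neg[(\varphi,\psi)]:=[(\boxminus_{\mathfrak p}\neg\psi,\neg\psi)]$. A double Boolean algebra (dBa) is an algebra $(D,\sqcup,\sqcap,\bar\neg,\lrcorner,\top,\bot)$ satisfying, for all $x,y,z$, with $x\bar\vee y:=\bar\neg(\bar\neg x\sqcap\bar\neg y)$ and $x\bar\wedge y:=\lrcorner(\lrcorner x\sqcup\lrcorner y)$: (1a) $(x\sqcap x)\sqcap y=x\sqcap y$; (1b) $(x\sqcup x)\sqcup y=x\sqcup y$; (2a) $x\sqcap y=y\sqcap x$; (2b) $x\sqcup y=y\sqcup x$; (3a) $\bar\neg(x\sqcap x)=\bar\neg x$; (3b) $\lrcorner(x\sqcup x)=\lrcorner x$; (4a) $x\sqcap(x\sqcup y)=x\sqcap x$; (4b) $x\sqcup(x\sqcap y)=x\sqcup x$; (5a) $x\sqcap(y\bar\vee z)=(x\sqcap y)\bar\vee(x\sqcap z)$; (5b) $x\sqcup(y\bar\wedge z)=(x\sqcup y)\bar\wedge(x\sqcup z)$; (6a) $x\sqcap(x\bar\vee y)=x\sqcap x$; (6b) $x\sqcup(x\bar\wedge y)=x\sqcup x$; (7a) $\bar\neg\bar\neg(x\sqcap y)=x\sqcap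 y$; (7b) $\lrcorner\lrcorner(x\sqcup y)=x\sqcup y$; (8a) $x\sqcap\bar\neg x=\bot$; (8b) $x\sqcup\lrcorner x=\top$; (9a) $\bar\neg\top=\bot$; (9b) $\lrcorner\bot=\top$; (10a) $x\sqcap(y\sqcap z)=(x\sqcap y)\sqcap z$; (10b) $x\sqcup(y\sqcup z)=(x\sqcup y)\sqcup z$; (11a) $\bar\neg\bot=\top\sqcap\top$; (11b) $\lrcorner\top=\bot\sqcup\bot$; (12) $(x\sqcap x)\sqcup(x\sqcap x)=(x\sqcup x)\sqcap(x\sqcup x)$. It is pure if for every $x$, $x\sqcap x=x$ or $x\sqcup x=x$. *)

theory Defs
  imports Main "HOL-Library.FuncSet"
begin

section \<open>Two-sorted formulas\<close>

text \<open>
  The propositional variables of the two sorts are the elements of the types \<open>'p\<close> and \<open>'q\<close>;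
  these are nonempty, and variables of different sorts are kept apart by typing.
  \<open>BoxP\<close>/\<open>WinP\<close> take a formula of the second sort to one of the first
  (box and window indexed by \<open>p\<close>), and \<open>BoxO\<close>/\<open>WinO\<close> go the other way (indexed by \<open>o\<close>).
\<close>

datatype ('p, 'q) fm1 =
    Var1 'p
  | Neg1 "('p, 'q) fm1"
  | And1 "('p, 'q) fm1" "('p, 'q) fm1"
  | BoxP "('p, 'q) fm2"
  | WinP "('p, 'q) fm2"
and ('p, 'q) fm2 =
    Var2 'q
  | Neg2 "('p, 'q) fm2"
  | And2 "('p, 'q) fm2" "('p, 'q) fm2"
  | BoxO "('p, 'q) fm1"
  | WinO "('p, 'q) fm1"

definition Iff1 :: "('p, 'q) fm1 \<Rightarrow> ('p, 'q) fm1 \<Rightarrow> ('p, 'q) fm1" where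
  "Iff1 \<phi> \<phi>' = And1 (Neg1 (And1 \<phi> (Neg1 \<phi>'))) (Neg1 (And1 \<phi>' (Neg1 \<phi>)))"

definition Iff2 :: "('p, 'q) fm2 \<Rightarrow> ('p, 'q) fm2 \<Rightarrow> ('p, 'q) fm2" where
  "Iff2 \<psi> \<psi>' = And2 (Neg2 (And2 \<psi> (Neg2 \<psi>'))) (Neg2 (And2 \<psi>' (Neg2 \<psi>)))"

text \<open>
  Falsum is not primitive: it abbreviates \<open>p \<and> \<not> p\<close> for an arbitrarily chosen variable \<open>p\<close>.
\<close>

definition Bot1 :: "('p, 'q) fm1" where
  "Bot1 = (let p = (SOME p. True) in And1 (Var1 p) (Neg1 (Var1 p)))"

definition Bot2 :: "('p, 'q) fm2" where
  "Bot2 = (let q = (SOME q. True) in And2 (Var2 q) (Neg2 (Var2 q)))"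


section \<open>Contexts and models\<close>

record ('g, 'm) fcontext =
  objects :: "'g set"
  attributes :: "'m set"
  incidence :: "('g \<times> 'm) set"

definition is_context :: "('g, 'm) fcontext \<Rightarrow> bool" where
  "is_context K \<longleftrightarrow> incidence K \<subseteq> objects K \<times> attributes K"

text \<open>
  The valuation of a model based on \<open>K\<close> is split into its restrictions \<open>v\<close> and \<open>w\<close> to the
  variables of the first and of the second sort.
\<close>

definition is_valuation ::
    "('g, 'm) fcontext \<Rightarrow> ('p \<Rightarrow> 'g set) \<Rightarrow> ('q \<Rightarrow> 'm set) \<Rightarrow> bool" where
  "is_valuation K v w \<longleftrightarrow> (\<forall>p. v p \<subseteq> objects K) \<and> (\<forall>q. w q \<subseteq> attributes K)"

primrec
  sat1 :: "('g, 'm) fcontext \<Rightarrow> ('p \<Rightarrow> 'g set) \<Rightarrow> ('q \<Rightarrow> 'm set) \<Rightarrow> ('p, 'q) fm1 \<Rightarrow> 'g \<Rightarrow> bool" and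
  sat2 :: "('g, 'm) fcontext \<Rightarrow> ('p \<Rightarrow> 'g set) \<Rightarrow> ('q \<Rightarrow> 'm set) \<Rightarrow> ('p, 'q) fm2 \<Rightarrow> 'm \<Rightarrow> bool"
where
  "sat1 K v w (Var1 p) = (\<lambda>g. g \<in> v p)"
| "sat1 K v w (Neg1 \<phi>) = (\<lambda>g. \<not> sat1 K v w \<phi> g)"
| "sat1 K v w (And1 \<phi> \<phi>') = (\<lambda>g. sat1 K v w \<phi> g \<and> sat1 K v w \<phi>' g)"
| "sat1 K v w (BoxP \<psi>) =
     (\<lambda>g. \<forall>m\<in>attributes K. (g, m) \<in> incidence K \<longrightarrow> sat2 K v w \<psi> m)"
| "sat1 K v w (WinP \<psi>) =
     (\<lambda>g. \<forall>m\<in>attributes K. sat2 K v w \<psi> m \<longrightarrow> (g, m) \<in> incidence K)"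
| "sat2 K v w (Var2 q) = (\<lambda>m. m \<in> w q)"
| "sat2 K v w (Neg2 \<psi>) = (\<lambda>m. \<not> sat2 K v w \<psi> m)"
| "sat2 K v w (And2 \<psi> \<psi>') = (\<lambda>m. sat2 K v w \<psi> m \<and> sat2 K v w \<psi>' m)"
| "sat2 K v w (BoxO \<phi>) =
     (\<lambda>m. \<forall>g\<in>objects K. (g, m) \<in> incidence K \<longrightarrow> sat1 K v w \<phi> g)"
| "sat2 K v w (WinO \<phi>) =
     (\<lambda>m. \<forall>g\<in>objects K. sat1 K v w \<phi> g \<longrightarrow> (g, m) \<in> incidence K)"

definition valid1 :: "('g, 'm) fcontext \<Rightarrow> ('p, 'q) fm1 \<Rightarrow> bool" where
  "valid1 K \<phi> \<longleftrightarrow> (\<forall>v w. is_valuation K v w \<longrightarrow> (\<forall>g\<in>objects K. sat1 K v w \<phi> g))"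

definition valid2 :: "('g, 'm) fcontext \<Rightarrow> ('p, 'q) fm2 \<Rightarrow> bool" where
  "valid2 K \<psi> \<longleftrightarrow> (\<forall>v w. is_valuation K v w \<longrightarrow> (\<forall>m\<in>attributes K. sat2 K v w \<psi> m))"


section \<open>Left and right semiconcepts\<close>

type_synonym ('p, 'q) fmpair = "('p, 'q) fm1 \<times> ('p, 'q) fm2"

definition SC_left :: "('g, 'm) fcontext \<Rightarrow> ('p, 'q) fmpair set" where
  "SC_left K = {(\<phi>, \<psi>). valid2 K (Iff2 (WinO \<phi>) \<psi>)}"

definition SC_right :: "('g, 'm) fcontext \<Rightarrow> ('p, 'q) fmpair set" where
  "SC_right K = {(\<phi>, \<psi>). valid1 K (Iff1 \<phi> (WinP \<psi>))}"

definition eq_left :: "('g, 'm) fcontext \<Rightarrow> (('p, 'q) fmpair \<times> ('p, 'q) fmpair) set" where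
  "eq_left K = {((\<phi>1, \<psi>1), (\<phi>2, \<psi>2)).
     (\<phi>1, \<psi>1) \<in> SC_left K \<and> (\<phi>2, \<psi>2) \<in> SC_left K \<and> valid1 K (Iff1 \<phi>1 \<phi>2)}"

definition eq_right :: "('g, 'm) fcontext \<Rightarrow> (('p, 'q) fmpair \<times> ('p, 'q) fmpair) set" where
  "eq_right K = {((\<phi>1, \<psi>1), (\<phi>2, \<psi>2)).
     (\<phi>1, \<psi>1) \<in> SC_right K \<and> (\<phi>2, \<psi>2) \<in> SC_right K \<and> valid2 K (Iff2 \<psi>1 \<psi>2)}"

definition Q_left :: "('g, 'm) fcontext \<Rightarrow> ('p, 'q) fmpair set set" where
  "Q_left K = SC_left K // eq_left K"

definition Q_right :: "('g, 'm) fcontext \<Rightarrow> ('p, 'q) fmpair set set" where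
  "Q_right K = SC_right K // eq_right K"

definition class_left :: "('g, 'm) fcontext \<Rightarrow> ('p, 'q) fmpair \<Rightarrow> ('p, 'q) fmpair set" where
  "class_left K a = eq_left K `` {a}"

definition class_right :: "('g, 'm) fcontext \<Rightarrow> ('p, 'q) fmpair \<Rightarrow> ('p, 'q) fmpair set" where
  "class_right K a = eq_right K `` {a}"

text \<open>
  The operations on classes follow the union idiom of \<^theory>\<open>HOL.Equiv_Relations\<close>; that they
  do not depend on representatives is the content of the equations proved below.
\<close>

definition meet_left ::
    "('g, 'm) fcontext \<Rightarrow> ('p, 'q) fmpair set \<Rightarrow> ('p, 'q) fmpair set \<Rightarrow> ('p, 'q) fmpair set" where
  "meet_left K X Y =
     (\<Union>(\<phi>, \<psi>)\<in>X. \<Union>(\<phi>', \<psi>')\<in>Y. class_left K (And1 \<phi> \<phi>', WinO (And1 \<phi> \<phi>')))"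

definition neg_left :: "('g, 'm) fcontext \<Rightarrow> ('p, 'q) fmpair set \<Rightarrow> ('p, 'q) fmpair set" where
  "neg_left K X = (\<Union>(\<phi>, \<psi>)\<in>X. class_left K (Neg1 \<phi>, WinO (Neg1 \<phi>)))"

definition join_right ::
    "('g, 'm) fcontext \<Rightarrow> ('p, 'q) fmpair set \<Rightarrow> ('p, 'q) fmpair set \<Rightarrow> ('p, 'q) fmpair set" where
  "join_right K X Y =
     (\<Union>(\<phi>, \<psi>)\<in>X. \<Union>(\<phi>', \<psi>')\<in>Y. class_right K (WinP (And2 \<psi> \<psi>'), And2 \<psi> \<psi>'))"

definition neg_right :: "('g, 'm) fcontext \<Rightarrow> ('p, 'q) fmpair set \<Rightarrow> ('p, 'q) fmpair set" where
  "neg_right K X = (\<Union>(\<phi>, \<psi>)\<in>X. class_right K (WinP (Neg2 \<psi>), Neg2 \<psi>))"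

lemma valid1_Iff1:
  "valid1 K (Iff1 \<phi> \<phi>') \<longleftrightarrow>
     (\<forall>v w. is_valuation K v w \<longrightarrow> (\<forall>g\<in>objects K. sat1 K v w \<phi> g = sat1 K v w \<phi>' g))"
  unfolding valid1_def Iff1_def by auto

lemma valid2_Iff2:
  "valid2 K (Iff2 \<psi> \<psi>') \<longleftrightarrow>
     (\<forall>v w. is_valuation K v w \<longrightarrow> (\<forall>m\<in>attributes K. sat2 K v w \<psi> m = sat2 K v w \<psi>' m))"
  unfolding valid2_def Iff2_def by auto

lemma WinO_in_SC_left [simp]: "(\<phi>, WinO \<phi>) \<in> SC_left K"
  by (simp add: SC_left_def valid2_Iff2)

lemma WinP_in_SC_right [simp]: "(WinP \<psi>, \<psi>) \<in> SC_right K"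
  by (simp add: SC_right_def valid1_Iff1)

lemma equiv_eq_left: "equiv (SC_left K) (eq_left K)"
  by (intro equivI refl_onI symI transI) (auto simp: eq_left_def valid1_Iff1)

lemma equiv_eq_right: "equiv (SC_right K) (eq_right K)"
  by (intro equivI refl_onI symI transI) (auto simp: eq_right_def valid2_Iff2)

lemma class_left_eq_iff:
  "(\<phi>, \<psi>) \<in> SC_left K \<Longrightarrow> (\<phi>', \<psi>') \<in> SC_left K \<Longrightarrow>
     class_left K (\<phi>, \<psi>) = class_left K (\<phi>', \<psi>') \<longleftrightarrow> valid1 K (Iff1 \<phi> \<phi>')"
  unfolding class_left_def
  by (subst eq_equiv_class_iff [OF equiv_eq_left]) (auto simp: eq_left_def)

lemma class_right_eq_iff:
  "(\<phi>, \<psi>) \<in> SC_right K \<Longrightarrow> (\<phi>', \<psi>') \<in> SC_right K \<Longrightarrow>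
     class_right K (\<phi>, \<psi>) = class_right K (\<phi>', \<psi>') \<longleftrightarrow> valid2 K (Iff2 \<psi> \<psi>')"
  unfolding class_right_def
  by (subst eq_equiv_class_iff [OF equiv_eq_right]) (auto simp: eq_right_def)

lemma meet_left_class:
  assumes "(\<phi>, \<psi>) \<in> SC_left K" "(\<phi>', \<psi>') \<in> SC_left K"
  shows "meet_left K (class_left K (\<phi>, \<psi>)) (class_left K (\<phi>', \<psi>')) =
           class_left K (And1 \<phi> \<phi>', WinO (And1 \<phi> \<phi>'))"
proof -
  let ?f = "\<lambda>a b. class_left K (And1 (fst a) (fst b), WinO (And1 (fst a) (fst b)))"
  have "congruent2 (eq_left K) (eq_left K) ?f"
    by (auto simp: congruent2_def class_left_eq_iff eq_left_def valid1_Iff1)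
  from UN_equiv_class2 [OF equiv_eq_left equiv_eq_left this assms]
  show ?thesis by (simp add: meet_left_def class_left_def split_def)
qed

lemma neg_left_class:
  assumes "(\<phi>, \<psi>) \<in> SC_left K"
  shows "neg_left K (class_left K (\<phi>, \<psi>)) = class_left K (Neg1 \<phi>, WinO (Neg1 \<phi>))"
proof -
  let ?f = "\<lambda>a. class_left K (Neg1 (fst a), WinO (Neg1 (fst a)))"
  have "congruent (eq_left K) ?f"
    by (auto simp: congruent_def class_left_eq_iff eq_left_def valid1_Iff1)
  from UN_equiv_class [OF equiv_eq_left this assms]
  show ?thesis by (simp add: neg_left_def class_left_def split_def)
qed

lemma join_right_class:
  assumes "(\<phi>, \<psi>) \<in> SC_right K" "(\<phi>', \<psi>') \<in> SC_right K"
  shows "join_right K (class_right K (\<phi>, \<psi>)) (class_right K (\<phi>', \<psi>')) =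
           class_right K (WinP (And2 \<psi> \<psi>'), And2 \<psi> \<psi>')"
proof -
  let ?f = "\<lambda>a b. class_right K (WinP (And2 (snd a) (snd b)), And2 (snd a) (snd b))"
  have "congruent2 (eq_right K) (eq_right K) ?f"
    by (auto simp: congruent2_def class_right_eq_iff eq_right_def valid2_Iff2)
  from UN_equiv_class2 [OF equiv_eq_right equiv_eq_right this assms]
  show ?thesis by (simp add: join_right_def class_right_def split_def)
qed

lemma neg_right_class:
  assumes "(\<phi>, \<psi>) \<in> SC_right K"
  shows "neg_right K (class_right K (\<phi>, \<psi>)) = class_right K (WinP (Neg2 \<psi>), Neg2 \<psi>)"
proof -
  let ?f = "\<lambda>a. class_right K (WinP (Neg2 (snd a)), Neg2 (snd a))"
  have "congruent (eq_right K) ?f"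
    by (auto simp: congruent_def class_right_eq_iff eq_right_def valid2_Iff2)
  from UN_equiv_class [OF equiv_eq_right this assms]
  show ?thesis by (simp add: neg_right_def class_right_def split_def)
qed


section \<open>Double Boolean algebras\<close>

text \<open>
  An algebra is given by a carrier set on which the operations are only required to be closed;
  the axioms are relativised to the carrier.
\<close>

locale dba_algebra =
  fixes D :: "'a set"
    and dsup :: "'a \<Rightarrow> 'a \<Rightarrow> 'a"  (infixl "\<squnion>" 65)
    and dinf :: "'a \<Rightarrow> 'a \<Rightarrow> 'a"  (infixl "\<sqinter>" 70)
    and dneg :: "'a \<Rightarrow> 'a"
    and dopp :: "'a \<Rightarrow> 'a"
    and dtop :: 'a  ("\<top>")
    and dbot :: 'a  ("\<bottom>")
  assumes sup_closed: "x \<in> D \<Longrightarrow> y \<in> D \<Longrightarrow> x \<squnion> y \<in> D"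
    and inf_closed: "x \<in> D \<Longrightarrow> y \<in> D \<Longrightarrow> x \<sqinter> y \<in> D"
    and neg_closed: "x \<in> D \<Longrightarrow> dneg x \<in> D"
    and opp_closed: "x \<in> D \<Longrightarrow> dopp x \<in> D"
    and top_closed: "\<top> \<in> D"
    and bot_closed: "\<bottom> \<in> D"
begin

definition bvee :: "'a \<Rightarrow> 'a \<Rightarrow> 'a" where
  "bvee x y = dneg (dneg x \<sqinter> dneg y)"

definition bwedge :: "'a \<Rightarrow> 'a \<Rightarrow> 'a" where
  "bwedge x y = dopp (dopp x \<squnion> dopp y)"

end

locale double_boolean_algebra = dba_algebra +
  assumes ax1a: "x \<in> D \<Longrightarrow> y \<in> D \<Longrightarrow> (x \<sqinter> x) \<sqinter> y = x \<sqinter> y"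
    and ax1b: "x \<in> D \<Longrightarrow> y \<in> D \<Longrightarrow> (x \<squnion> x) \<squnion> y = x \<squnion> y"
    and ax2a: "x \<in> D \<Longrightarrow> y \<in> D \<Longrightarrow> x \<sqinter> y = y \<sqinter> x"
    and ax2b: "x \<in> D \<Longrightarrow> y \<in> D \<Longrightarrow> x \<squnion> y = y \<squnion> x"
    and ax3a: "x \<in> D \<Longrightarrow> dneg (x \<sqinter> x) = dneg x"
    and ax3b: "x \<in> D \<Longrightarrow> dopp (x \<squnion> x) = dopp x"
    and ax4a: "x \<in> D \<Longrightarrow> y \<in> D \<Longrightarrow> x \<sqinter> (x \<squnion> y) = x \<sqinter> x"
    and ax4b: "x \<in> D \<Longrightarrow> y \<in> D \<Longrightarrow> x \<squnion> (x \<sqinter> y) = x \<squnion> x"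
    and ax5a: "x \<in> D \<Longrightarrow> y \<in> D \<Longrightarrow> z \<in> D \<Longrightarrow> x \<sqinter> (bvee y z) = bvee (x \<sqinter> y) (x \<sqinter> z)"
    and ax5b: "x \<in> D \<Longrightarrow> y \<in> D \<Longrightarrow> z \<in> D \<Longrightarrow> x \<squnion> (bwedge y z) = bwedge (x \<squnion> y) (x \<squnion> z)"
    and ax6a: "x \<in> D \<Longrightarrow> y \<in> D \<Longrightarrow> x \<sqinter> (bvee x y) = x \<sqinter> x"
    and ax6b: "x \<in> D \<Longrightarrow> y \<in> D \<Longrightarrow> x \<squnion> (bwedge x y) = x \<squnion> x"
    and ax7a: "x \<in> D \<Longrightarrow> y \<in> D \<Longrightarrow> dneg (dneg (x \<sqinter> y)) = x \<sqinter> y"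
    and ax7b: "x \<in> D \<Longrightarrow> y \<in> D \<Longrightarrow> dopp (dopp (x \<squnion> y)) = x \<squnion> y"
    and ax8a: "x \<in> D \<Longrightarrow> x \<sqinter> dneg x = \<bottom>"
    and ax8b: "x \<in> D \<Longrightarrow> x \<squnion> dopp x = \<top>"
    and ax9a: "dneg \<top> = \<bottom>"
    and ax9b: "dopp \<bottom> = \<top>"
    and ax10a: "x \<in> D \<Longrightarrow> y \<in> D \<Longrightarrow> z \<in> D \<Longrightarrow> x \<sqinter> (y \<sqinter> z) = (x \<sqinter> y) \<sqinter> z"
    and ax10b: "x \<in> D \<Longrightarrow> y \<in> D \<Longrightarrow> z \<in> D \<Longrightarrow> x \<squnion> (y \<squnion> z) = (x \<squnion> y) \<squnion> z"
    and ax11a: "dneg \<bottom> = \<top> \<sqinter> \<top>"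
    and ax11b: "dopp \<top> = \<bottom> \<squnion> \<bottom>"
    and ax12: "x \<in> D \<Longrightarrow> (x \<sqinter> x) \<squnion> (x \<sqinter> x) = (x \<squnion> x) \<sqinter> (x \<squnion> x)"

locale pure_double_boolean_algebra = double_boolean_algebra +
  assumes pure: "x \<in> D \<Longrightarrow> x \<sqinter> x = x \<or> x \<squnion> x = x"

end

theory Submission
  imports Defs
begin

text \<open>
  A left semiconcept is determined up to equivalence by its first component, and a right one by
  its second, so conjunction and negation make each of the two quotients a Boolean algebra.
  Pulling either of them back along its retraction gives every axiom that mentions one of \<open>\<sqinter>\<close>
  and \<open>\<squnion>\<close> alone; the remaining axioms and purity, which link the two, are the conditions
  (a)--(d) up to rewriting.
\<close>

text \<open>
  The axioms of a Boolean algebra in terms of meet and complement, in the redundant form in which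
  the double Boolean algebra axioms use them. The right quotient is an instance with
  \<open>join_right\<close> as its meet.
\<close>

locale meet_boolean_algebra =
  fixes Q :: "'b set"
    and meet :: "'b \<Rightarrow> 'b \<Rightarrow> 'b"
    and neg :: "'b \<Rightarrow> 'b"
    and zero :: 'b
  assumes meet_closed: "X \<in> Q \<Longrightarrow> Y \<in> Q \<Longrightarrow> meet X Y \<in> Q"
    and neg_closed: "X \<in> Q \<Longrightarrow> neg X \<in> Q"
    and zero_closed: "zero \<in> Q"
    and meet_idem: "X \<in> Q \<Longrightarrow> meet X X = X"
    and meet_commute: "X \<in> Q \<Longrightarrow> Y \<in> Q \<Longrightarrow> meet X Y = meet Y X"
    and meet_assoc: "X \<in> Q \<Longrightarrow> Y \<in> Q \<Longrightarrow> Z \<in> Q \<Longrightarrow> meet (meet X Y) Z = meet X (meet Y Z)"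
    and neg_neg: "X \<in> Q \<Longrightarrow> neg (neg X) = X"
    and meet_neg: "X \<in> Q \<Longrightarrow> meet X (neg X) = zero"
    and meet_absorb: "X \<in> Q \<Longrightarrow> Y \<in> Q \<Longrightarrow> meet X (neg (meet (neg X) (neg Y))) = X"
    and meet_distrib: "X \<in> Q \<Longrightarrow> Y \<in> Q \<Longrightarrow> Z \<in> Q \<Longrightarrow>
      meet X (neg (meet (neg Y) (neg Z))) = neg (meet (neg (meet X Y)) (neg (meet X Z)))"

text \<open>Since \<open>r\<close> need not be injective, only the image of \<open>e\<close> is a
  copy of \<open>Q\<close>. Pulled back to \<open>D\<close>, the meet of \<open>x\<close> with
  itself is \<open>e (r x)\<close>, which may differ from \<open>x\<close>.\<close>

locale boolean_retract = meet_boolean_algebra +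
  fixes D :: "'a set"
    and r :: "'a \<Rightarrow> 'b"
    and e :: "'b \<Rightarrow> 'a"
  assumes r_closed: "x \<in> D \<Longrightarrow> r x \<in> Q"
    and e_closed: "X \<in> Q \<Longrightarrow> e X \<in> D"
    and r_e: "X \<in> Q \<Longrightarrow> r (e X) = X"
begin

lemma meet_left_commute:
  "X \<in> Q \<Longrightarrow> Y \<in> Q \<Longrightarrow> Z \<in> Q \<Longrightarrow> meet X (meet Y Z) = meet Y (meet X Z)"
  by (metis meet_assoc meet_commute)

lemmas meet_ac = meet_assoc meet_commute meet_left_commute
lemmas closed = meet_closed neg_closed zero_closed r_closed e_closed
lemmas boolean_simps = closed r_e meet_idem neg_neg meet_neg meet_absorb meet_distrib

end

locale boolean_retract_pair =
  L: boolean_retract Q meet neg zero D r e +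
  R: boolean_retract Q' meet' neg' zero' D r' e'
  for D :: "'a set"
    and Q :: "'b set" and meet neg zero r e
    and Q' :: "'c set" and meet' neg' zero' r' e'
begin

theorem pure_double_boolean_algebra_iff:
  "pure_double_boolean_algebra D
      (\<lambda>x y. e' (meet' (r' x) (r' y))) (\<lambda>x y. e (meet (r x) (r y)))
      (\<lambda>x. e (neg (r x))) (\<lambda>x. e' (neg' (r' x))) (e' zero') (e zero)
    \<longleftrightarrow>
      (\<forall>x \<in> D. e (r (e' (r' x))) = e' (r' (e (r x))))
    \<and> (\<forall>x \<in> D. \<forall>y \<in> D.
          e (meet (r x) (r (e' (meet' (r' x) (r' y))))) = e (r x)
        \<and> e' (meet' (r' x) (r' (e (meet (r x) (r y))))) = e' (r' x))
    \<and> (r (e' zero') = neg zero \<and> r' (e zero) = neg' zero')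
    \<and> (\<forall>x \<in> D. e (r x) = x \<or> e' (r' x) = x)"
  (is "?dba \<longleftrightarrow> ?a \<and> ?b \<and> ?c \<and> ?d")
proof
  assume ?dba
  then interpret pure_double_boolean_algebra D
      "\<lambda>x y. e' (meet' (r' x) (r' y))" "\<lambda>x y. e (meet (r x) (r y))"
      "\<lambda>x. e (neg (r x))" "\<lambda>x. e' (neg' (r' x))" "e' zero'" "e zero" .
  \<comment> \<open>By idempotence in \<open>Q\<close> and \<open>Q'\<close>, the two sides of
    \<open>ax12\<close> are \<open>e' (r' (e (r x)))\<close> and
    \<open>e (r (e' (r' x)))\<close>.\<close>
  have ?a
    using ax12 by (simp add: L.boolean_simps R.boolean_simps)
  moreover have ?b
    using ax4a ax4b by (simp add: L.boolean_simps R.boolean_simps)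
  \<comment> \<open>\<open>ax11a\<close> reads \<open>e (neg zero) = e (r (e' zero'))\<close>;
    applying \<open>r\<close> cancels \<open>e\<close>.\<close>
  moreover have "r (e' zero') = neg zero"
    using arg_cong [OF ax11a, of r] by (simp add: L.boolean_simps R.boolean_simps)
  moreover have "r' (e zero) = neg' zero'"
    using arg_cong [OF ax11b, of r'] by (simp add: L.boolean_simps R.boolean_simps)
  moreover have ?d
    using pure by (simp add: L.boolean_simps R.boolean_simps)
  ultimately show "?a \<and> ?b \<and> ?c \<and> ?d"
    by blast
next
  assume conditions: "?a \<and> ?b \<and> ?c \<and> ?d"
  \<comment> \<open>This makes \<open>bvee_def\<close> and \<open>bwedge_def\<close> available for
    these operations.\<close>
  interpret dba_algebra D
      "\<lambda>x y. e' (meet' (r' x) (r' y))" "\<lambda>x y. e (meet (r x) (r y))"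
      "\<lambda>x. e (neg (r x))" "\<lambda>x. e' (neg' (r' x))" "e' zero'" "e zero"
    by unfold_locales (simp_all add: L.closed R.closed)
  \<comment> \<open>Axioms 4 come from (b), 9 and 11 from (c), 12 from (a), purity from (d); all
    others are Boolean laws under \<open>e\<close> or \<open>e'\<close>.\<close>
  show ?dba
    by unfold_locales
      (use conditions in \<open>simp_all add: bvee_def bwedge_def L.boolean_simps R.boolean_simps
        L.meet_ac R.meet_ac\<close>)
qed

end

text \<open>\<open>eq_left\<close> compares first components only, so the second may be replaced by
  \<open>WinO \<phi>\<close>, which makes the pair a left semiconcept for every
  \<open>\<phi>\<close>.\<close>

lemma Q_leftE:
  assumes "X \<in> Q_left K"
  obtains \<phi> where "X = class_left K (\<phi>, WinO \<phi>)"
proof -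
  from assms obtain \<phi> \<psi> where "(\<phi>, \<psi>) \<in> SC_left K" "X = class_left K (\<phi>, \<psi>)"
    by (auto simp: Q_left_def quotient_def class_left_def)
  then show thesis
    using that [of \<phi>] by (simp add: class_left_eq_iff valid1_Iff1)
qed

lemma Q_rightE:
  assumes "X \<in> Q_right K"
  obtains \<psi> where "X = class_right K (WinP \<psi>, \<psi>)"
proof -
  from assms obtain \<phi> \<psi> where "(\<phi>, \<psi>) \<in> SC_right K" "X = class_right K (\<phi>, \<psi>)"
    by (auto simp: Q_right_def quotient_def class_right_def)
  then show thesis
    using that [of \<psi>] by (simp add: class_right_eq_iff valid2_Iff2)
qed

lemma class_left_in_Q_left [simp]: "class_left K (\<phi>, WinO \<phi>) \<in> Q_left K"
  by (simp add: Q_left_def class_left_def quotientI)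

lemma class_right_in_Q_right [simp]: "class_right K (WinP \<psi>, \<psi>) \<in> Q_right K"
  by (simp add: Q_right_def class_right_def quotientI)

text \<open>On representatives, each law becomes a validity of \<open>Iff1\<close>, that is, a
  propositional tautology at each object.\<close>

lemma meet_boolean_algebra_left:
  "meet_boolean_algebra (Q_left K) (meet_left K) (neg_left K) (class_left K (Bot1, WinO Bot1))"
  by (unfold_locales; (elim Q_leftE)?;
    simp add: meet_left_class neg_left_class class_left_eq_iff valid1_Iff1 Bot1_def Let_def; blast?)

text \<open>Conjunction of second components acts as meet here, so the zero is the class that
  \<open>e'\<close> sends to the top of \<open>D\<close>.\<close>

lemma meet_boolean_algebra_right:
  "meet_boolean_algebra (Q_right K) (join_right K) (neg_right K) (class_right K (WinP Bot2, Bot2))"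
  by (unfold_locales; (elim Q_rightE)?;
    simp add: join_right_class neg_right_class class_right_eq_iff valid2_Iff2 Bot2_def Let_def; blast?)

theorem theorem5p2:
  fixes K :: "('g, 'm) fcontext"
    and D :: "('p, 'q) fmpair set"
    and r :: "('p, 'q) fmpair \<Rightarrow> ('p, 'q) fmpair set"
    and e :: "('p, 'q) fmpair set \<Rightarrow> ('p, 'q) fmpair"
    and r' :: "('p, 'q) fmpair \<Rightarrow> ('p, 'q) fmpair set"
    and e' :: "('p, 'q) fmpair set \<Rightarrow> ('p, 'q) fmpair"
  assumes "is_context K"
    and "r \<in> D \<rightarrow> Q_left K"
    and "e \<in> Q_left K \<rightarrow> D"
    and "r' \<in> D \<rightarrow> Q_right K"
    and "e' \<in> Q_right K \<rightarrow> D"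
    and "\<forall>X \<in> Q_left K. r (e X) = X"
    and "\<forall>X \<in> Q_right K. r' (e' X) = X"
  shows "pure_double_boolean_algebra D
      (\<lambda>x y. e' (join_right K (r' x) (r' y)))
      (\<lambda>x y. e (meet_left K (r x) (r y)))
      (\<lambda>x. e (neg_left K (r x)))
      (\<lambda>x. e' (neg_right K (r' x)))
      (e' (class_right K (WinP Bot2, Bot2)))
      (e (class_left K (Bot1, WinO Bot1)))
    \<longleftrightarrow>
      (\<forall>x \<in> D. (e \<circ> r \<circ> e' \<circ> r') x = (e' \<circ> r' \<circ> e \<circ> r) x)
    \<and> (\<forall>x \<in> D. \<forall>y \<in> D.
          e (meet_left K (r x) (r (e' (join_right K (r' x) (r' y))))) = e (r x)
        \<and> e' (join_right K (r' x) (r' (e (meet_left K (r x) (r y))))) = e' (r' x))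
    \<and> (r (e' (class_right K (WinP Bot2, Bot2))) = neg_left K (class_left K (Bot1, WinO Bot1))
        \<and> r' (e (class_left K (Bot1, WinO Bot1))) = neg_right K (class_right K (WinP Bot2, Bot2)))
    \<and> (\<forall>x \<in> D. e (r x) = x \<or> e' (r' x) = x)"
proof -
  interpret boolean_retract_pair D
      "Q_left K" "meet_left K" "neg_left K" "class_left K (Bot1, WinO Bot1)" r e
      "Q_right K" "join_right K" "neg_right K" "class_right K (WinP Bot2, Bot2)" r' e'
    using assms
    by (intro boolean_retract_pair.intro boolean_retract.intro boolean_retract_axioms.intro
        meet_boolean_algebra_left meet_boolean_algebra_right) auto
  show ?thesis
    using pure_double_boolean_algebra_iff by simp
qed

end
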